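(* Let $w\in R_n(1/2/3/4)$, with largest letter $m$ (so $m\le 3$). Consider the following forms: (A) $w=1^{h_1}2^{h_2}3^{h_3}$ (weakly increasing; $h_i$ is the number of $i$s in $w$); (B) $m=3$, $w=w_aw_b3^c$, where $w_a$ ends with the last $1$ of $w$ and $w_b$ ends with the last $2$ of $w$; (C) $m=3$, $w=w_aw_b3^c$, where $w_a$ ends with the last $2$ and $w_b$ ends with the last $1$; (D) $m=3$, $w=w_aw_b2^c$, where $w_a$ ends with the last $3$ and $w_b$ ends with the last $1$; (E) $m=3$, $w=w_aw_b2^c$, where $w_a$ ends with the last $1$ and $w_b$ ends with the last $3$; (F) $m=3$, $w=w_aw_b1^c$, where $w_a$ ends with the last $2$ and $w_b$ ends with the last $3$; (G) $m=3$, $w=w_aw_b1^c$, where $w_a$ ends with the last $3$ and $w_b$ ends with the last $2$; (H) $m=2$, $w=w_a2^b$, where $w_a$ ends with the last $1$; (I) $m=2$, $w=w_a1^b$, where $w_a$ ends with the last $2$; where $c\ge1$ and $b\ge1$, $w_a$ contains $a_1$ $1$s, $a_2$ $2$s, $a_3$ $3$s, and $w_b$ contains $b_1$ $1$s, $b_2$ $2$s and $b_3$ $3$s. Then $$rb(w)=\begin{cases}(m-1)h_1+(m-2)h_2 & w \text{ of form (A)}\\ 2a_1+a_2+b_2 & w\text{ of form (B) or (E)}\\ 2a_1+a_2+b_1 & w\text{ of form (C), (D), (F) or (G)}\\ a_1 & w\text{ of form (H) or (I)}\end{cases}$$ and $$rs(w)=\begin{cases}0 & w \text{ of form (A)}\\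 a_2+2a_3+b_3 & w\text{ of form (B), (C), (E) or (F)}\\ a_2+2a_3+b_2 & w\text{ of form (D) or (G)}\\ a_2 & w\text{ of form (H) or (I)}.\end{cases}$$
   Context: A set partition $\sigma$ of $[n]=\{1,\dots,n\}$ is written $\sigma=B_1/B_2/\dots/B_m$ with blocks ordered so that $\min B_1<\dots<\min B_m$. To it corresponds the restricted growth function (RGF) $w(\sigma)=w_1\cdots w_n$ with $w_i=j$ if $i\in B_j$; RGFs are exactly the words of positive integers with $w_1=1$ and $w_i\le1+\max\{w_1,\dots,w_{i-1}\}$ for $i\ge 2$. $\sigma$ contains a pattern $\pi$ (a set partition of $[k]$) if for some $A\subseteq[n]$ the partition of $A$ formed by the nonempty sets $A\cap B_i$, relabelled order-preservingly by $1,\dots,|A|$, equals $\pi$; otherwise it avoids $\pi$. $R_n(\pi)$ is the set of $w(\sigma)$ for $\sigma$ a set partition of $[n]$ avoiding $\pi$. The pattern $1/2/3/4$ is the partition of $[4]$ into singletons; $R_n(1/2/3/4)$ is the set of RGFs of length $n$ using only letters $1,2,3$. Statistics (counting distinct letter values): $rb(w)=\sum_{i=1}^n|\{w_j: j>i,\ w_j>w_i\}|$ and $rs(w)=\sum_{i=1}^n|\{w_j: j>i,\ w_j<w_i\}|$. The notation $j^c$ means $c$ consecutive copies of the letter $j$. *)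

theory Defs
  imports Main "HOL-Library.Disjoint_Sets"
begin

text \<open>
  A set partition of $[n]$ is a set of blocks \<open>P\<close> with \<open>partition_on {1..n} P\<close>.
  \<open>ordered_blocks P\<close> is the list $B_1,\dots,B_m$ of its blocks with
  $\min B_1 < \dots < \min B_m$; list positions start at 0, so $B_j$ is
  \<open>ordered_blocks P ! (j - 1)\<close>.
\<close>

definition ordered_blocks :: "nat set set \<Rightarrow> nat set list" where
  "ordered_blocks P = sorted_key_list_of_set Min P"

definition rgf :: "nat \<Rightarrow> nat set set \<Rightarrow> nat list" where
  "rgf n P =
     map (\<lambda>i. THE j. 1 \<le> j \<and> j \<le> length (ordered_blocks P) \<and> i \<in> ordered_blocks P ! (j - 1))
       [1..<Suc n]"

definition subpartition :: "nat set set \<Rightarrow> nat set \<Rightarrow> nat set set" where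
  "subpartition P A = ((\<lambda>B. A \<inter> B) ` P) - {{}}"

text \<open>
  \<open>\<lambda>x. card {y \<in> A. y \<le> x}\<close> is the order-preserving relabelling of a finite set \<open>A\<close>
  by $1,\dots,|A|$.
\<close>

definition standardize :: "nat set \<Rightarrow> nat set set \<Rightarrow> nat set set" where
  "standardize A Q = (\<lambda>B. (\<lambda>x. card {y \<in> A. y \<le> x}) ` B) ` Q"

definition contains_pattern :: "nat set set \<Rightarrow> nat set set \<Rightarrow> bool" where
  "contains_pattern P \<pi> \<longleftrightarrow> (\<exists>A \<subseteq> \<Union>P. standardize A (subpartition P A) = \<pi>)"

definition R :: "nat \<Rightarrow> nat set set \<Rightarrow> nat list set" where
  "R n \<pi> = {rgf n P | P. partition_on {1..n} P \<and> \<not> contains_pattern P \<pi>}"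

definition rb :: "nat list \<Rightarrow> nat" where
  "rb w = (\<Sum>i<length w. card {w ! j | j. i < j \<and> j < length w \<and> w ! j > w ! i})"

definition rs :: "nat list \<Rightarrow> nat" where
  "rs w = (\<Sum>i<length w. card {w ! j | j. i < j \<and> j < length w \<and> w ! j < w ! i})"

text \<open>The \<open>insert 0\<close> only matters for the empty word (\<open>n = 0\<close>), whose largest letter is set to 0.\<close>

definition largest_letter :: "nat list \<Rightarrow> nat" where
  "largest_letter w = Max (insert 0 (set w))"

text \<open>The factor \<open>u\<close> of a word, followed in that word by exactly \<open>v\<close>, ends with the word's last \<open>x\<close>.\<close>

definition ends_with_last :: "nat \<Rightarrow> nat list \<Rightarrow> nat list \<Rightarrow> bool" where
  "ends_with_last x u v \<longleftrightarrow> u \<noteq> [] \<and> last u = x \<and> x \<notin> set v"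

definition form3 :: "nat \<Rightarrow> nat \<Rightarrow> nat \<Rightarrow> nat list \<Rightarrow> nat list \<Rightarrow> nat list \<Rightarrow> nat \<Rightarrow> bool" where
  "form3 x y z w wa wb c \<longleftrightarrow>
     largest_letter w = 3 \<and> c \<ge> 1 \<and> w = wa @ wb @ replicate c z \<and>
     ends_with_last x wa (wb @ replicate c z) \<and> ends_with_last y wb (replicate c z)"

definition form2 :: "nat \<Rightarrow> nat \<Rightarrow> nat list \<Rightarrow> nat list \<Rightarrow> nat \<Rightarrow> bool" where
  "form2 x z w wa b \<longleftrightarrow>
     largest_letter w = 2 \<and> b \<ge> 1 \<and> w = wa @ replicate b z \<and> ends_with_last x wa (replicate b z)"

definition form_A :: "nat list \<Rightarrow> nat \<Rightarrow> nat \<Rightarrow> nat \<Rightarrow> bool" where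
  "form_A w h1 h2 h3 \<longleftrightarrow> w = replicate h1 1 @ replicate h2 2 @ replicate h3 3"

definition "form_B = form3 1 2 3"
definition "form_C = form3 2 1 3"
definition "form_D = form3 3 1 2"
definition "form_E = form3 1 3 2"
definition "form_F = form3 2 3 1"
definition "form_G = form3 3 2 1"
definition "form_H = form2 1 2"
definition "form_I = form2 2 1"

end

theory Submission
  imports Defs
begin

text \<open>
  Only two facts about \<open>w\<close> matter: its set of letters is $\{1,\dots,m\}$, and $m \le 3$. Cut \<open>w\<close>
  after the last occurrence of the letter that disappears first, and cut the rest again in the same
  way. Before such a cut every position is followed by all the letters
  still present, except that the letter at the cut no longer follows itself, which is invisible to
  strict comparisons. So each letter before the cut contributes an amount that depends on its value only.
\<close>

section \<open>Counting, position by position, the distinct later letters in a given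
  relation\<close>

text \<open>The two statistics are this count for the two opposite strict orders, so the structural
  arguments are made once, for a general \<open>r\<close>.\<close>

definition follow_count :: "('a \<Rightarrow> 'a \<Rightarrow> bool) \<Rightarrow> 'a list \<Rightarrow> nat" where
  "follow_count r w = (\<Sum>i<length w. card {w ! j | j. i < j \<and> j < length w \<and> r (w ! i) (w ! j)})"

lemma rb_eq_follow_count: "rb = follow_count (<)"
  by (simp add: fun_eq_iff rb_def follow_count_def)

lemma rs_eq_follow_count: "rs = follow_count (>)"
  by (simp add: fun_eq_iff rs_def follow_count_def)

lemma follow_count_Nil [simp]: "follow_count r [] = 0"
  by (simp add: follow_count_def)

text \<open>The head is followed by exactly the letters of \<open>w\<close>, and shifting indices by
  one preserves the other summands. Thus positions give way to recursion on lists, in which only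
  sets of later letters matter.\<close>

lemma follow_count_Cons [simp]:
  "follow_count r (x # w) = card {y \<in> set w. r x y} + follow_count r w"
proof -
  have hd: "{(x # w) ! j | j. 0 < j \<and> j < length (x # w) \<and> r ((x # w) ! 0) ((x # w) ! j)}
      = {y \<in> set w. r x y}" (is "?L = ?R")
  proof (intro equalityI subsetI)
    fix y assume "y \<in> ?L"
    then obtain j where "y = (x # w) ! j" "0 < j" "j < length (x # w)" "r x y"
      by auto
    then show "y \<in> ?R"
      by (cases j) auto
  next
    fix y assume "y \<in> ?R"
    then obtain k where "k < length w" "w ! k = y" "r x y"
      by (auto simp: in_set_conv_nth)
    then show "y \<in> ?L"
      by (intro CollectI exI[of _ "Suc k"]) simp
  qed
  have tl: "{(x # w) ! j | j. Suc i < j \<and> j < length (x # w) \<and> r ((x # w) ! Suc i) ((x # w) ! j)}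
      = {w ! j | j. i < j \<and> j < length w \<and> r (w ! i) (w ! j)}" (is "?L = ?R") for i
  proof (intro equalityI subsetI)
    fix y assume "y \<in> ?L"
    then obtain j where "y = (x # w) ! j" "Suc i < j" "j < length (x # w)" "r (w ! i) y"
      by auto
    then show "y \<in> ?R"
      by (cases j) auto
  next
    fix y assume "y \<in> ?R"
    then obtain k where "y = w ! k" "i < k" "k < length w" "r (w ! i) y"
      by blast
    then show "y \<in> ?L"
      by (intro CollectI exI[of _ "Suc k"]) simp
  qed
  let ?f = "\<lambda>i. card {(x # w) ! j | j. i < j \<and> j < length (x # w) \<and> r ((x # w) ! i) ((x # w) ! j)}"
  have "follow_count r (x # w) = (\<Sum>i<Suc (length w). ?f i)"
    by (simp only: follow_count_def length_Cons)
  also have "\<dots> = ?f 0 + (\<Sum>i<length w. ?f (Suc i))"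
    by (rule sum.lessThan_Suc_shift)
  finally show ?thesis
    by (simp only: hd tl follow_count_def[of r w])
qed

text \<open>Later copies of \<open>x\<close> in the same run are invisible to an irreflexive
  \<open>r\<close>, so each copy sees only \<open>v\<close>. The run may be empty, as form (A)
  requires.\<close>

lemma follow_count_replicate_append:
  assumes "irreflp r"
  shows "follow_count r (replicate h x @ v) = h * card {y \<in> set v. r x y} + follow_count r v"
proof (induction h)
  case (Suc h)
  have "{y \<in> set (replicate h x @ v). r x y} = {y \<in> set v. r x y}"
    using assms by (auto simp: irreflp_def)
  with Suc show ?case by simp
qed simp

lemma follow_count_replicate [simp]: "irreflp r \<Longrightarrow> follow_count r (replicate h x) = 0"
  using follow_count_replicate_append[of r h x "[]"] by simp

text \<open>Every position of \<open>u\<close> before the cut is still followed by the final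
  \<open>x\<close> and by all of \<open>v\<close>, and no other letters exist. Hence its summand
  depends on its letter alone.\<close>

lemma follow_count_append:
  assumes "irreflp r" "ends_with_last x u v" "set u \<subseteq> insert x (set v)"
  shows "follow_count r (u @ v) =
    (\<Sum>a\<leftarrow>u. card {y \<in> insert x (set v). r a y}) + follow_count r v"
  using assms(2,3)
proof (induction u)
  case (Cons a u)
  show ?case
  proof (cases "u = []")
    \<comment> \<open>This is the position of the cut: \<open>a\<close> is \<open>x\<close>, which
      no longer occurs in \<open>v\<close>. Since \<open>r x x\<close> fails, counting over
      \<open>insert x (set v)\<close> gives the same number.\<close>
    case True
    with Cons.prems have "a = x"
      by (simp add: ends_with_last_def)
    moreover have "{y \<in> insert x (set v). r x y} = {y \<in> set v. r x y}"
      using assms(1) by (auto simp: irreflp_def)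
    ultimately show ?thesis
      using True by simp
  next
    case False
    with Cons.prems have ends: "ends_with_last x u v"
      by (simp add: ends_with_last_def)
    then have "x \<in> set u"
      by (auto simp: ends_with_last_def)
    with Cons.prems have "set (u @ v) = insert x (set v)"
      by auto
    moreover have "follow_count r (u @ v) =
        (\<Sum>a\<leftarrow>u. card {y \<in> insert x (set v). r a y}) + follow_count r v"
      using Cons.IH[OF ends] Cons.prems(2) by simp
    ultimately show ?thesis
      by (simp only: append_Cons follow_count_Cons list.map sum_list.Cons add.assoc)
  qed
qed (simp add: ends_with_last_def)

section \<open>Existence of the forms\<close>

text \<open>The cut goes right after the earliest of all last occurrences, so every other letter
  still occurs in \<open>v\<close>. If the head recurs, the cut of the tail serves; if not, the head
  itself is the first letter to finish.\<close>

lemma exists_first_finished_letter: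
  assumes "w \<noteq> []"
  shows "\<exists>x u v. w = u @ v \<and> ends_with_last x u v \<and> x \<in> set w \<and> set v = set w - {x}"
  using assms
proof (induction w)
  case (Cons a w)
  show ?case
  proof (cases "a \<in> set w")
    case True
    then have "w \<noteq> []"
      by auto
    then obtain x u v where uv: "w = u @ v" "ends_with_last x u v" "x \<in> set w" "set v = set w - {x}"
      using Cons.IH by blast
    have "set (a # w) = set w"
      using True by auto
    moreover have "a # w = (a # u) @ v"
      using uv(1) by simp
    moreover have "ends_with_last x (a # u) v"
      using uv(2) by (simp add: ends_with_last_def)
    ultimately show ?thesis
      using uv(3,4) by metis
  next
    case False
    then have "a # w = [a] @ w" "ends_with_last a [a] w" "a \<in> set (a # w)" "set w = set (a # w) - {a}"
      by (simp_all add: ends_with_last_def)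
    then show ?thesis by blast
  qed
qed simp

lemma replicate_of_singleton_set:
  assumes "set v = {z}"
  obtains c where "v = replicate c z" "c \<ge> 1"
proof
  show "v = replicate (length v) z"
    using assms by (intro replicate_eqI) simp_all
  show "length v \<ge> 1"
    using assms by (cases v) simp_all
qed

lemma largest_letter_of_set:
  assumes "set w = {1..k}"
  shows "largest_letter w = k"
  using assms unfolding largest_letter_def by (auto intro!: Max_eqI)

lemma letters_upto_3: "{1..3::nat} = {1, 2, 3}"
  by auto

lemma form3_exists:
  assumes "set w = {1..3}"
  shows "\<exists>wa wb c. form_B w wa wb c \<or> form_C w wa wb c \<or> form_D w wa wb c \<or>
                 form_E w wa wb c \<or> form_F w wa wb c \<or> form_G w wa wb c"
proof -
  have "w \<noteq> []" using assms by auto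
  then obtain x wa v where x: "w = wa @ v" "ends_with_last x wa v" "x \<in> {1, 2, 3}"
      "set v = {1, 2, 3} - {x}"
    using exists_first_finished_letter[of w] assms letters_upto_3 by metis
  have "set v \<noteq> {}"
    unfolding x(4) using x(3) by auto
  then have "v \<noteq> []" by simp
  then obtain y wb t where y: "v = wb @ t" "ends_with_last y wb t" "y \<in> {1, 2, 3} - {x}"
      "set t = {1, 2, 3} - {x} - {y}"
    using exists_first_finished_letter[of v] x(4) by metis
  \<comment> \<open>The triple records the order in which the letters finish. The six permutations
    are listed in the order of forms (B) to (G).\<close>
  have "\<exists>z. set t = {z} \<and>
      (x, y, z) \<in> {(1,2,3), (2,1,3), (3,1,2), (1,3,2), (2,3,1), (3,2,1)}"
    using x(3) y(3) unfolding y(4)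
    by (elim insertE emptyE DiffE; simp add: insert_Diff_if)
  then obtain z where z: "set t = {z}"
      "(x, y, z) \<in> {(1,2,3), (2,1,3), (3,1,2), (1,3,2), (2,3,1), (3,2,1)}"
    by blast
  obtain c where c: "t = replicate c z" "c \<ge> 1"
    using replicate_of_singleton_set[OF z(1)] .
  have "form3 x y z w wa wb c"
    using x(1,2) y(1,2) c largest_letter_of_set[OF assms] unfolding form3_def by simp
  then show ?thesis
    using z(2)
    unfolding form_B_def form_C_def form_D_def form_E_def form_F_def form_G_def by blast
qed

lemma form2_exists:
  assumes "set w = {1..2}"
  shows "\<exists>wa b. form_H w wa b \<or> form_I w wa b"
proof -
  have 12: "{1..2::nat} = {1, 2}" by auto
  have "w \<noteq> []" using assms by auto
  then obtain x wa v where x: "w = wa @ v" "ends_with_last x wa v" "x \<in> {1, 2}"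
      "set v = {1, 2} - {x}"
    using exists_first_finished_letter[of w] assms 12 by metis
  have "\<exists>z. set v = {z} \<and> (x, z) \<in> {(1,2), (2,1)}"
    using x(3) unfolding x(4) by (elim insertE emptyE; simp add: insert_Diff_if)
  then obtain z where z: "set v = {z}" "(x, z) \<in> {(1,2), (2,1)}"
    by blast
  obtain b where b: "v = replicate b z" "b \<ge> 1"
    using replicate_of_singleton_set[OF z(1)] .
  have "form2 x z w wa b"
    using x(1,2) b largest_letter_of_set[OF assms] unfolding form2_def by simp
  then show ?thesis
    using z(2)
    unfolding form_H_def form_I_def by blast
qed

lemma form_A_exists:
  assumes "set w = {1..k}" "k \<le> 1"
  shows "\<exists>h1 h2 h3. form_A w h1 h2 h3"
proof -
  \<comment> \<open>The empty word is included: for \<open>k = 0\<close> the length is 0.\<close>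
  have "w = replicate (length w) 1"
    using assms by (intro replicate_eqI) auto
  then have "form_A w (length w) 0 0"
    by (simp add: form_A_def)
  then show ?thesis by blast
qed

section \<open>Values of the statistics on each form\<close>

lemma sum_list_over_letters:
  fixes f :: "nat \<Rightarrow> nat"
  assumes "set u \<subseteq> {1, 2, 3}"
  shows "(\<Sum>a\<leftarrow>u. f a) = count_list u 1 * f 1 + count_list u 2 * f 2 + count_list u 3 * f 3"
  using sum_list_map_eq_sum_count2[OF assms, of f] by simp

text \<open>The sizes 2, 1, 0 are the coefficients with which the letters 1, 2, 3 of
  \<open>wa\<close> enter \<open>rb\<close>; the sizes in \<open>smaller_letters\<close> play the
  same part for \<open>rs\<close>.\<close>

lemma larger_letters:
  "{y \<in> {1, 2, 3::nat}. 1 < y} = {2, 3}" "{y \<in> {1, 2, 3::nat}. 2 < y} = {3}"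
  "{y \<in> {1, 2, 3::nat}. 3 < y} = {}"
  by auto

lemma smaller_letters:
  "{y \<in> {1, 2, 3::nat}. y < 1} = {}" "{y \<in> {1, 2, 3::nat}. y < 2} = {1}"
  "{y \<in> {1, 2, 3::nat}. y < 3} = {1, 2}"
  by auto

lemma sum_list_two_letters:
  fixes f :: "'a \<Rightarrow> nat"
  assumes "set u \<subseteq> {p, q}" "p \<noteq> q"
  shows "(\<Sum>a\<leftarrow>u. f a) = count_list u p * f p + count_list u q * f q"
  using sum_list_map_eq_sum_count2[OF assms(1), of f] assms(2) by simp

text \<open>With two letters in play, only the smaller one has a larger letter to see, and it sees
  exactly one.\<close>

lemma two_letter_larger:
  fixes p q :: nat
  assumes "set u \<subseteq> {p, q}" "p < q"
  shows "(\<Sum>a\<leftarrow>u. card {y \<in> {p, q}. a < y}) = count_list u p"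
proof -
  have "{y \<in> {p, q}. p < y} = {q}" "{y \<in> {p, q}. q < y} = {}"
    using assms(2) by auto
  then show ?thesis
    using sum_list_two_letters[OF assms(1), of "\<lambda>a. card {y \<in> {p, q}. a < y}"] assms(2)
    by simp
qed

lemma two_letter_smaller:
  fixes p q :: nat
  assumes "set u \<subseteq> {p, q}" "p < q"
  shows "(\<Sum>a\<leftarrow>u. card {y \<in> {p, q}. y < a}) = count_list u q"
proof -
  have "{y \<in> {p, q}. y < p} = {}" "{y \<in> {p, q}. y < q} = {p}"
    using assms(2) by auto
  then show ?thesis
    using sum_list_two_letters[OF assms(1), of "\<lambda>a. card {y \<in> {p, q}. y < a}"] assms(2)
    by simp
qed

lemma irreflp_order: "irreflp ((<) :: nat \<Rightarrow> nat \<Rightarrow> bool)" "irreflp ((>) :: nat \<Rightarrow> nat \<Rightarrow> bool)"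
  by (auto simp: irreflp_def)

text \<open>\<open>follow_count_append\<close> is applied at both cuts: three letters are in play
  before the first, only \<open>y\<close> and \<open>z\<close> between the two, and the constant
  tail contributes nothing.\<close>

lemma form3_follow_count:
  assumes "form3 x y z w wa wb c" "set w = {1..3}" "irreflp r"
  shows "follow_count r w = (\<Sum>a\<leftarrow>wa. card {b \<in> {1, 2, 3}. r a b}) + (\<Sum>a\<leftarrow>wb. card {b \<in> {y, z}. r a b})"
    and "set wa \<subseteq> {1, 2, 3}" "set wb \<subseteq> {y, z}" "y \<noteq> z"
proof -
  have w: "w = wa @ wb @ replicate c z" "c \<ge> 1" "ends_with_last x wa (wb @ replicate c z)"
      "ends_with_last y wb (replicate c z)"
    using assms(1) by (auto simp: form3_def)
  have x: "x \<in> set wa" "x \<notin> set wb" "x \<noteq> z" and y: "y \<in> set wb" and "y \<noteq> z"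
    using w(2-4) by (auto simp: ends_with_last_def)
  \<comment> \<open>Three pairwise distinct letters of a three-letter word exhaust its alphabet, so
    all six forms are treated at once.\<close>
  have "{x, y, z} \<subseteq> set w"
    using x y w(1,2) by auto
  moreover have "x \<noteq> y"
    using x y by auto
  then have "card {x, y, z} = 3"
    using \<open>x \<noteq> z\<close> \<open>y \<noteq> z\<close> by simp
  ultimately have xyz: "{x, y, z} = {1, 2, 3}"
    using card_subset_eq[of "set w" "{x, y, z}"] assms(2) letters_upto_3 by simp
  show "y \<noteq> z" by fact
  have sub: "set wa \<subseteq> {1, 2, 3}" "set wb \<subseteq> {1, 2, 3}"
    using assms(2) w(1) letters_upto_3 by auto
  show "set wa \<subseteq> {1, 2, 3}" by fact
  show wb: "set wb \<subseteq> {y, z}"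
    using sub(2) x unfolding xyz[symmetric] by auto
  have v: "set (wb @ replicate c z) = {y, z}"
    using wb y w(2) by auto
  then have xv: "insert x (set (wb @ replicate c z)) = {1, 2, 3}"
    using xyz by simp
  have yz: "insert y (set (replicate c z)) = {y, z}"
    using w(2) by simp
  show "follow_count r w = (\<Sum>a\<leftarrow>wa. card {b \<in> {1, 2, 3}. r a b}) + (\<Sum>a\<leftarrow>wb. card {b \<in> {y, z}. r a b})"
    using follow_count_append[OF assms(3) w(3), unfolded xv, OF sub(1)]
      follow_count_append[OF assms(3) w(4), unfolded yz, OF wb] assms(3)
    by (simp add: w(1))
qed

text \<open>In \<open>wb\<close> only the smaller remaining letter contributes.
  \<open>min y z\<close> is 2 for forms (B), (E) and 1 for (C), (D), (F), (G), which explains the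
  grouping of the forms.\<close>

lemma form3_rb:
  assumes "form3 x y z w wa wb c" "set w = {1..3}"
  shows "rb w = 2 * count_list wa 1 + count_list wa 2 + count_list wb (min y z)"
proof -
  note f = form3_follow_count[OF assms irreflp_order(1)]
  have "{y, z} = {min y z, max y z}" "min y z < max y z"
    using f(4) by (auto simp: min_def max_def)
  then have "(\<Sum>a\<leftarrow>wb. card {b \<in> {y, z}. a < b}) = count_list wb (min y z)"
    using two_letter_larger[of wb "min y z" "max y z"] f(3) by simp
  then show ?thesis
    unfolding rb_eq_follow_count f(1) sum_list_over_letters[OF f(2)] larger_letters by simp
qed

text \<open>Dually, only the larger remaining letter of \<open>wb\<close> contributes:
  \<open>max y z\<close> is 3 for (B), (C), (E), (F) and 2 for (D), (G).\<close>

lemma form3_rs: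
  assumes "form3 x y z w wa wb c" "set w = {1..3}"
  shows "rs w = count_list wa 2 + 2 * count_list wa 3 + count_list wb (max y z)"
proof -
  note f = form3_follow_count[OF assms irreflp_order(2)]
  have "{y, z} = {min y z, max y z}" "min y z < max y z"
    using f(4) by (auto simp: min_def max_def)
  then have "(\<Sum>a\<leftarrow>wb. card {b \<in> {y, z}. b < a}) = count_list wb (max y z)"
    using two_letter_smaller[of wb "min y z" "max y z"] f(3) by simp
  then show ?thesis
    unfolding rs_eq_follow_count f(1) sum_list_over_letters[OF f(2)] smaller_letters by simp
qed

lemma form2_stats:
  assumes "form2 x z w wa b" "set w = {1..2}"
  shows "rb w = count_list wa 1" "rs w = count_list wa 2"
proof -
  have w: "w = wa @ replicate b z" "b \<ge> 1" "ends_with_last x wa (replicate b z)"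
    using assms(1) by (auto simp: form2_def)
  have "{1..2::nat} = {1, 2}" by auto
  then have set_w: "set w = {1, 2}"
    using assms(2) by simp
  then have wa: "set wa \<subseteq> {1, 2}"
    using w(1) by auto
  have "x \<in> set wa" "x \<noteq> z"
    using w(2,3) by (auto simp: ends_with_last_def)
  then have "{x, z} \<subseteq> {1, 2}" "x \<noteq> z"
    using set_w w(1,2) by auto
  then have xz: "insert x (set (replicate b z)) = {1, 2}"
    using w(2) by auto
  show "rb w = count_list wa 1"
    using follow_count_append[OF irreflp_order(1) w(3), unfolded xz, OF wa] two_letter_larger[OF wa]
    by (simp add: rb_eq_follow_count w(1) irreflp_order)
  show "rs w = count_list wa 2"
    using follow_count_append[OF irreflp_order(2) w(3), unfolded xz, OF wa] two_letter_smaller[OF wa]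
    by (simp add: rs_eq_follow_count w(1) irreflp_order)
qed

text \<open>Over the integers \<open>k - 1\<close> and \<open>k - 2\<close> may be negative, but
  only where the multiplicity they multiply is 0.\<close>

lemma form_A_stats:
  assumes "form_A w h1 h2 h3" "set w = {1..k}"
  shows "int (rb w) = (int k - 1) * int h1 + (int k - 2) * int h2" "rs w = 0"
proof -
  have w: "w = replicate h1 1 @ replicate h2 2 @ replicate h3 3"
    using assms(1) by (simp add: form_A_def)
  \<comment> \<open>Each set is empty when its run is. Naming them postpones that case distinction
    until \<open>k\<close> is known.\<close>
  define s2 s3 :: "nat set" where "s2 = set (replicate h2 2)" and "s3 = set (replicate h3 3)"
  have rb: "rb w = h1 * card {y \<in> s2 \<union> s3. 1 < y} + h2 * card {y \<in> s3. 2 < y}"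
    by (simp add: w rb_eq_follow_count follow_count_replicate_append irreflp_order s2_def s3_def)
  have "{y \<in> s2 \<union> s3. y < 1} = {}" "{y \<in> s3. y < 2} = {}"
    by (auto simp: s2_def s3_def)
  then show "rs w = 0"
    by (simp add: w rs_eq_follow_count follow_count_replicate_append irreflp_order s2_def s3_def)
  \<comment> \<open>Which runs are nonempty can be read off from the letters present, hence from
    \<open>k\<close>.\<close>
  have in_w: "1 \<in> set w \<longleftrightarrow> h1 > 0" "2 \<in> set w \<longleftrightarrow> h2 > 0" "3 \<in> set w \<longleftrightarrow> h3 > 0"
    by (auto simp: w)
  have "set w \<subseteq> {1, 2, 3}"
    by (auto simp: w)
  then have "k \<le> 3"
    unfolding assms(2) by (cases "k = 0") (auto dest: subsetD[of _ _ k])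
  then consider "k = 0" | "k = 1" | "k = 2" | "k = 3"
    by linarith
  then show "int (rb w) = (int k - 1) * int h1 + (int k - 2) * int h2"
  proof cases
    case 3
    then have "s2 = {2}" "s3 = {}"
      using in_w assms(2) by (auto simp: s2_def s3_def)
    moreover have "{y. y = (2::nat) \<and> 1 < y} = {2}" by auto
    ultimately show ?thesis
      using 3 by (simp add: rb)
  next
    case 4
    then have s: "s2 = {2}" "s3 = {3}"
      using in_w assms(2) by (auto simp: s2_def s3_def)
    have "{y \<in> {2} \<union> {3::nat}. 1 < y} = {2, 3}" "{y \<in> {3::nat}. 2 < y} = {3}" by auto
    then show ?thesis
      using 4 unfolding rb s by simp
  next
    case 1
    then have "h1 = 0" "h2 = 0"
      using in_w assms(2) by simp_all
    then show ?thesis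
      by (simp add: rb)
  next
    case 2
    then have "h2 = 0" "h3 = 0"
      using in_w assms(2) by simp_all
    then show ?thesis
      using 2 by (simp add: rb s2_def s3_def)
  qed
qed

section \<open>The letters of a restricted growth function\<close>

text \<open>\<open>Min\<close> is injective on the blocks of a partition but not on all sets, so the
  sorting facts are obtained relative to the carrier \<open>P\<close>.\<close>

lemma (in linorder) sorted_key_list_of_set_inj_on:
  assumes "inj_on f P" "finite P"
  shows "set (sorted_key_list_of_set f P) = P" "distinct (sorted_key_list_of_set f P)"
proof -
  interpret key: folding_insort_key "(\<le>)" "(<)" P f
    using assms(1) by unfold_locales
  show "set (sorted_key_list_of_set f P) = P"
    using assms(2) by simp
  show "distinct (sorted_key_list_of_set f P)"
    using key.distinct_sorted_key_list_of_set[of P] by (simp add: distinct_map)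
qed

text \<open>Blocks are nonempty and disjoint, so different blocks have different minima and sorting
  by \<open>Min\<close> loses none.\<close>

lemma ordered_blocks_facts:
  assumes "partition_on {1..n} P"
  shows "set (ordered_blocks P) = P" "distinct (ordered_blocks P)" "finite P"
proof -
  show "finite P"
    using finite_elements[OF _ assms] by simp
  have fin: "finite B" "B \<noteq> {}" if "B \<in> P" for B
    using that assms finite_subset[of B "{1..n}"] by (auto simp: partition_on_def)
  have "inj_on Min P"
  proof (rule inj_onI)
    fix B C assume "B \<in> P" "C \<in> P" "Min B = Min C"
    then have "Min B \<in> B \<inter> C"
      using fin Min_in by (metis IntI)
    then show "B = C"
      using assms \<open>B \<in> P\<close> \<open>C \<in> P\<close> by (auto simp: partition_on_def disjoint_def)
  qed
  then show "set (ordered_blocks P) = P" "distinct (ordered_blocks P)"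
    unfolding ordered_blocks_def using \<open>finite P\<close> by (rule sorted_key_list_of_set_inj_on)+
qed

text \<open>Covering and disjointness make the \<open>THE\<close> in \<open>rgf\<close> well
  defined, and nonempty blocks make every index occur as a letter.\<close>

lemma set_rgf:
  assumes "partition_on {1..n} P"
  shows "set (rgf n P) = {1..card P}"
proof -
  let ?L = "ordered_blocks P"
  note L = ordered_blocks_facts[OF assms]
  have len: "length ?L = card P"
    using L distinct_card by metis
  define Q where "Q i j \<longleftrightarrow> 1 \<le> j \<and> j \<le> length ?L \<and> i \<in> ?L ! (j - 1)" for i j
  have uniq: "j = j'" if "Q i j" "Q i j'" for i j j'
  proof -
    have "?L ! (j - 1) \<in> P" "?L ! (j' - 1) \<in> P"
      using that L(1) nth_mem unfolding Q_def
      by (metis diff_less less_le_trans less_one nat_less_le not_le zero_less_one)+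
    then have "?L ! (j - 1) = ?L ! (j' - 1)"
      using that assms unfolding Q_def partition_on_def disjoint_def by blast
    then have "j - 1 = j' - 1"
      using that L(2) nth_eq_iff_index_eq[of ?L "j - 1" "j' - 1"] unfolding Q_def by auto
    \<comment> \<open>Truncated subtraction identifies 0 and 1, so the lower bounds are needed to
      cancel the shift.\<close>
    moreover have "1 \<le> j" "1 \<le> j'"
      using that unfolding Q_def by blast+
    ultimately show ?thesis
      by linarith
  qed
  have the: "(THE j. Q i j) = j" if "Q i j" for i j
    using that uniq by blast
  have rgf: "set (rgf n P) = (\<lambda>i. THE j. Q i j) ` {1..n}"
    unfolding rgf_def Q_def by auto
  have total: "\<exists>j. Q i j" if i: "i \<in> {1..n}" for i
  proof -
    obtain B where "B \<in> P" "i \<in> B"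
      using i assms unfolding partition_on_def by blast
    then obtain k where "k < length ?L" "?L ! k = B"
      using L(1) by (metis in_set_conv_nth)
    then have "Q i (Suc k)"
      using \<open>i \<in> B\<close> by (simp add: Q_def)
    then show ?thesis ..
  qed
  have onto: "\<exists>i\<in>{1..n}. Q i j" if j: "j \<in> {1..card P}" for j
  proof -
    have "?L ! (j - 1) \<in> P"
      using j L(1) len by (metis One_nat_def Suc_pred atLeastAtMost_iff less_eq_Suc_le nth_mem)
    then have "?L ! (j - 1) \<noteq> {}" "?L ! (j - 1) \<subseteq> {1..n}"
      using assms unfolding partition_on_def by (metis, blast)
    then obtain i where "i \<in> ?L ! (j - 1)" "i \<in> {1..n}"
      by blast
    then show ?thesis
      using j len by (auto simp: Q_def)
  qed
  show ?thesis
  proof (intro equalityI subsetI)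
    fix j assume "j \<in> set (rgf n P)"
    then obtain i where "i \<in> {1..n}" "j = (THE j. Q i j)"
      unfolding rgf by blast
    then have "Q i j"
      using total the by metis
    then show "j \<in> {1..card P}"
      using len by (simp add: Q_def)
  next
    fix j assume "j \<in> {1..card P}"
    then obtain i where i: "i \<in> {1..n}" "Q i j"
      using onto[of j] by blast
    show "j \<in> set (rgf n P)"
      unfolding rgf using the[OF i(2), symmetric] i(1) by (rule image_eqI)
  qed
qed

section \<open>Avoiding 1/2/3/4 bounds the number of blocks\<close>

text \<open>Rank is strictly increasing on \<open>A\<close>, hence injective, and takes values
  between 1 and \<open>card A\<close>; equal cardinalities then force equality.\<close>

lemma rank_image:
  fixes A :: "nat set"
  assumes "finite A"
  shows "(\<lambda>x. card {y \<in> A. y \<le> x}) ` A = {1..card A}"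
proof (rule card_subset_eq)
  let ?rank = "\<lambda>x. card {y \<in> A. y \<le> x}"
  have mono: "?rank x < ?rank x'" if "x' \<in> A" "x < x'" for x x'
  proof (intro psubset_card_mono psubsetI)
    have "x' \<in> {y \<in> A. y \<le> x'} - {y \<in> A. y \<le> x}"
      using that by simp
    then show "{y \<in> A. y \<le> x} \<noteq> {y \<in> A. y \<le> x'}"
      by blast
  qed (use that assms in auto)
  have "inj_on ?rank A"
  proof (rule inj_onI)
    fix x x' assume "x \<in> A" "x' \<in> A" "?rank x = ?rank x'"
    then show "x = x'"
      using mono[of x x'] mono[of x' x] by (cases x x' rule: linorder_cases) simp_all
  qed
  then show "card (?rank ` A) = card {1..card A}"
    by (simp add: card_image)
  have "0 < ?rank x" if "x \<in> A" for x
    using that assms by (auto simp: card_gt_0_iff)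
  then show "?rank ` A \<subseteq> {1..card A}"
    using assms by (auto intro!: card_mono simp: Suc_le_eq)
qed simp

text \<open>One representative from each of \<open>k\<close> blocks forms a set \<open>A\<close>
  that induces the partition into singletons; relabelling by rank turns these into the singletons of
  \<open>{1..k}\<close>.\<close>

lemma contains_singletons:
  assumes "partition_on X P" "finite P" "k \<le> card P"
  shows "contains_pattern P ((\<lambda>i. {i}) ` {1..k})"
proof -
  obtain S where S: "S \<subseteq> P" "card S = k" "finite S"
    using obtain_subset_with_card_n[OF assms(3)] by blast
  have dis: "B = C" if "B \<in> P" "C \<in> P" "x \<in> B" "x \<in> C" for B C x
    using that assms(1) unfolding partition_on_def disjoint_def by blast
  define pick where "pick B = (SOME x. x \<in> B)" for B :: "nat set"
  have pick: "pick B \<in> B" if "B \<in> P" for B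
    using that assms(1) unfolding pick_def partition_on_def by (metis some_in_eq)
  have inj: "inj_on pick S"
    using pick dis S(1) by (intro inj_onI) (metis subsetD)
  define A where "A = pick ` S"
  have A: "finite A" "card A = k"
    using S inj by (auto simp: A_def card_image)
  have single: "A \<inter> B = {pick B}" if "B \<in> S" for B
    using that pick dis S(1) unfolding A_def by blast
  have "subpartition P A = (\<lambda>x. {x}) ` A"
  proof (intro equalityI subsetI)
    fix C assume "C \<in> subpartition P A"
    \<comment> \<open>\<open>x\<close> exists because \<open>subpartition\<close> discards empty
      intersections. It represents some chosen block, which must be \<open>B\<close> by
      disjointness.\<close>
    then obtain B x where B: "B \<in> P" "C = A \<inter> B" "x \<in> A" "x \<in> B"
      unfolding subpartition_def by blast
    then obtain B' where "B' \<in> S" "x = pick B'"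
      unfolding A_def by blast
    then have "B = B'"
      using B pick dis S(1) by (metis subsetD)
    then show "C \<in> (\<lambda>x. {x}) ` A"
      using single \<open>B' \<in> S\<close> B(2,3) \<open>x = pick B'\<close> by auto
  next
    fix C assume "C \<in> (\<lambda>x. {x}) ` A"
    then obtain B where "B \<in> S" "C = {pick B}"
      unfolding A_def by blast
    then show "C \<in> subpartition P A"
      using single[of B] S(1) unfolding subpartition_def by auto
  qed
  then have "standardize A (subpartition P A) = (\<lambda>i. {i}) ` (\<lambda>x. card {y \<in> A. y \<le> x}) ` A"
    unfolding standardize_def by (simp add: image_image)
  also have "\<dots> = (\<lambda>i. {i}) ` {1..k}"
    using rank_image[OF A(1)] A(2) by simp
  finally have "standardize A (subpartition P A) = (\<lambda>i. {i}) ` {1..k}" .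
  moreover have "A \<subseteq> \<Union>P"
    using pick S(1) unfolding A_def by blast
  ultimately show ?thesis
    unfolding contains_pattern_def by blast
qed

text \<open>Four blocks would already give the pattern, and the letters are exactly the block
  indices.\<close>

lemma set_of_R:
  assumes "w \<in> R n {{1}, {2}, {3}, {4}}"
  obtains k where "set w = {1..k}" "k \<le> 3"
proof -
  obtain P where P: "w = rgf n P" "partition_on {1..n} P"
      "\<not> contains_pattern P {{1}, {2}, {3}, {4}}"
    using assms unfolding R_def by blast
  have "{1..4::nat} = {1, 2, 3, 4}" by auto
  then have "(\<lambda>i. {i}) ` {1..4::nat} = {{1}, {2}, {3}, {4}}" by simp
  then have "\<not> 4 \<le> card P"
    using contains_singletons[OF P(2) ordered_blocks_facts(3)[OF P(2)], of 4] P(3) by metis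
  then show ?thesis
    using that[of "card P"] set_rgf[OF P(2)] P(1) by simp
qed

section \<open>Classification and values combined\<close>

theorem theorem4p3:
  fixes n m :: nat and w :: "nat list"
  assumes "w \<in> R n {{1}, {2}, {3}, {4}}"
    and "m = largest_letter w"
  shows
    "m \<le> 3 \<and>
     ((\<exists>h1 h2 h3. form_A w h1 h2 h3) \<or>
      (\<exists>wa wb c. form_B w wa wb c \<or> form_C w wa wb c \<or> form_D w wa wb c \<or>
                 form_E w wa wb c \<or> form_F w wa wb c \<or> form_G w wa wb c) \<or>
      (\<exists>wa b. form_H w wa b \<or> form_I w wa b)) \<and>

     (\<forall>h1 h2 h3. form_A w h1 h2 h3 \<longrightarrow>
        int (rb w) = (int m - 1) * int h1 + (int m - 2) * int h2) \<and>
     (\<forall>wa wb c. form_B w wa wb c \<or> form_E w wa wb c \<longrightarrow>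
        rb w = 2 * count_list wa 1 + count_list wa 2 + count_list wb 2) \<and>
     (\<forall>wa wb c. form_C w wa wb c \<or> form_D w wa wb c \<or> form_F w wa wb c \<or> form_G w wa wb c \<longrightarrow>
        rb w = 2 * count_list wa 1 + count_list wa 2 + count_list wb 1) \<and>
     (\<forall>wa b. form_H w wa b \<or> form_I w wa b \<longrightarrow> rb w = count_list wa 1) \<and>

     (\<forall>h1 h2 h3. form_A w h1 h2 h3 \<longrightarrow> rs w = 0) \<and>
     (\<forall>wa wb c. form_B w wa wb c \<or> form_C w wa wb c \<or> form_E w wa wb c \<or> form_F w wa wb c \<longrightarrow>
        rs w = count_list wa 2 + 2 * count_list wa 3 + count_list wb 3) \<and>
     (\<forall>wa wb c. form_D w wa wb c \<or> form_G w wa wb c \<longrightarrow>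
        rs w = count_list wa 2 + 2 * count_list wa 3 + count_list wb 2) \<and>
     (\<forall>wa b. form_H w wa b \<or> form_I w wa b \<longrightarrow> rs w = count_list wa 2)"
proof -
  obtain k where "set w = {1..k}" "k \<le> 3"
    using set_of_R[OF assms(1)] .
  moreover have "m = k"
    using assms(2) largest_letter_of_set calculation(1) by simp
  ultimately have w: "set w = {1..m}" and m: "m \<le> 3"
    by simp_all
  \<comment> \<open>The forms overlap: a weakly increasing word with letters 1, 2, 3 is also of form
    (B). Exhaustiveness therefore takes (A) only for \<open>m \<le> 1\<close>, while the values are
    derived form by form.\<close>
  consider "m \<le> 1" | "m = 2" | "m = 3"
    using m by linarith
  then have forms: "(\<exists>h1 h2 h3. form_A w h1 h2 h3) \<or>
      (\<exists>wa wb c. form_B w wa wb c \<or> form_C w wa wb c \<or> form_D w wa wb c \<or>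
                 form_E w wa wb c \<or> form_F w wa wb c \<or> form_G w wa wb c) \<or>
      (\<exists>wa b. form_H w wa b \<or> form_I w wa b)"
    using form_A_exists form2_exists form3_exists w by cases metis+
  have stats3: "rb w = 2 * count_list wa 1 + count_list wa 2 + count_list wb (min y z)"
    "rs w = count_list wa 2 + 2 * count_list wa 3 + count_list wb (max y z)"
    if "form3 x y z w wa wb c" for x y z wa wb c
  proof -
    \<comment> \<open>The form fixes only the largest letter; that 1, 2, 3 all occur comes from the
      letter set of \<open>w\<close> being \<open>{1..m}\<close>.\<close>
    have "m = 3"
      using that unfolding assms(2) form3_def by blast
    then have "set w = {1..3}"
      using w by simp
    then show "rb w = 2 * count_list wa 1 + count_list wa 2 + count_list wb (min y z)"
      "rs w = count_list wa 2 + 2 * count_list wa 3 + count_list wb (max y z)"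
      using form3_rb form3_rs that by blast+
  qed
  have stats2: "rb w = count_list wa 1" "rs w = count_list wa 2"
    if "form2 x z w wa b" for x z wa b
  proof -
    have "m = 2"
      using that unfolding assms(2) form2_def by blast
    then have "set w = {1..2}"
      using w by simp
    then show "rb w = count_list wa 1" "rs w = count_list wa 2"
      using form2_stats that by blast+
  qed
  have BE: "rb w = 2 * count_list wa 1 + count_list wa 2 + count_list wb 2"
    if "form_B w wa wb c \<or> form_E w wa wb c" for wa wb c
    using that stats3(1)[of 1 2 3 wa wb c] stats3(1)[of 1 3 2 wa wb c]
    by (auto simp: form_B_def form_E_def min_def)
  have CDFG: "rb w = 2 * count_list wa 1 + count_list wa 2 + count_list wb 1"
    if "form_C w wa wb c \<or> form_D w wa wb c \<or> form_F w wa wb c \<or> form_G w wa wb c" for wa wb c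
    using that stats3(1)[of 2 1 3 wa wb c] stats3(1)[of 3 1 2 wa wb c]
      stats3(1)[of 2 3 1 wa wb c] stats3(1)[of 3 2 1 wa wb c]
    by (auto simp: form_C_def form_D_def form_F_def form_G_def min_def)
  have BCEF: "rs w = count_list wa 2 + 2 * count_list wa 3 + count_list wb 3"
    if "form_B w wa wb c \<or> form_C w wa wb c \<or> form_E w wa wb c \<or> form_F w wa wb c" for wa wb c
    using that stats3(2)[of 1 2 3 wa wb c] stats3(2)[of 2 1 3 wa wb c]
      stats3(2)[of 1 3 2 wa wb c] stats3(2)[of 2 3 1 wa wb c]
    by (auto simp: form_B_def form_C_def form_E_def form_F_def max_def)
  have DG: "rs w = count_list wa 2 + 2 * count_list wa 3 + count_list wb 2"
    if "form_D w wa wb c \<or> form_G w wa wb c" for wa wb c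
    using that stats3(2)[of 3 1 2 wa wb c] stats3(2)[of 3 2 1 wa wb c]
    by (auto simp: form_D_def form_G_def max_def)
  have HI: "rb w = count_list wa 1" "rs w = count_list wa 2"
    if "form_H w wa b \<or> form_I w wa b" for wa b
    using that stats2[of 1 2 wa b] stats2[of 2 1 wa b]
    by (auto simp: form_H_def form_I_def)
  show ?thesis
    by (intro conjI allI impI m forms)
      (fact form_A_stats[OF _ w] BE CDFG HI BCEF DG)+
qed

end
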